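(* Let $p\ge 3$ and $n\ge 2$. Then the Sierpiński graph $S_p^n$ is an EOCD graph if and only if $p$ is even.
   Context: For $p\ge1$, $n\ge1$, the Sierpiński graph $S_p^n$ has vertex set $\{0,\dots,p-1\}^n$, vertices written $s=s_n\ldots s_1$; vertices $s_n\ldots s_1$ and $t_n\ldots t_1$ are adjacent iff there is $\delta\in\{1,\dots,n\}$ such that $s_d=t_d$ for $d>\delta$, $s_\delta\ne t_\delta$, and $s_d=t_\delta$, $t_d=s_\delta$ for all $d<\delta$. A set $P$ is an ECD set if the closed neighborhoods $N[v]$, $v\in P$, partition the vertex set; a set $D$ is an EOD set if the open neighborhoods $N(v)$, $v\in D$, partition the vertex set; a graph is an EOCD graph if it has both an ECD set and an EOD set. *)

theory Defs
  imports
    "HOL-Library.FuncSet"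
    "HOL-Library.Disjoint_Sets"
    "Graph_Theory.Pair_Digraph"
begin

text \<open>
  A simple graph is a symmetric, loop-free pair digraph (locale \<open>pair_graph\<close>): an edge between
  \<open>u\<close> and \<open>v\<close> is represented by the two arcs \<open>(u, v)\<close> and \<open>(v, u)\<close>.
\<close>

definition open_nbhd :: "'a pair_pre_digraph \<Rightarrow> 'a \<Rightarrow> 'a set" where
  "open_nbhd G v = {u \<in> pverts G. (v, u) \<in> parcs G}"

definition closed_nbhd :: "'a pair_pre_digraph \<Rightarrow> 'a \<Rightarrow> 'a set" where
  "closed_nbhd G v = insert v (open_nbhd G v)"

text \<open>
  ``The neighborhoods of the members of the set partition the vertex set'' is read for the family
  indexed by the members: distinct members have disjoint neighborhoods, so every vertex lies in
  the neighborhood of exactly one member. (Applying \<open>partition_on\<close> to the image set would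
  allow two distinct members with the same neighborhood.)
\<close>

definition is_ECD_set :: "'a pair_pre_digraph \<Rightarrow> 'a set \<Rightarrow> bool" where
  "is_ECD_set G P \<longleftrightarrow>
     P \<subseteq> pverts G \<and> disjoint_family_on (closed_nbhd G) P \<and> (\<Union>v\<in>P. closed_nbhd G v) = pverts G"

definition is_EOD_set :: "'a pair_pre_digraph \<Rightarrow> 'a set \<Rightarrow> bool" where
  "is_EOD_set G D \<longleftrightarrow>
     D \<subseteq> pverts G \<and> disjoint_family_on (open_nbhd G) D \<and> (\<Union>v\<in>D. open_nbhd G v) = pverts G"

definition is_EOCD_graph :: "'a pair_pre_digraph \<Rightarrow> bool" where
  "is_EOCD_graph G \<longleftrightarrow> (\<exists>P. is_ECD_set G P) \<and> (\<exists>D. is_EOD_set G D)"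

text \<open>
  The word \<open>s\<^sub>n\<dots>s\<^sub>1\<close> over \<open>{0, \<dots>, p - 1}\<close> is the function
  \<open>s\<close> with \<open>s d = s\<^sub>d\<close> for \<open>d \<in> {1..n}\<close>; the extensional function space makes
  this representation unique.
\<close>

definition sierpinski_verts :: "nat \<Rightarrow> nat \<Rightarrow> (nat \<Rightarrow> nat) set" where
  "sierpinski_verts p n = {1..n} \<rightarrow>\<^sub>E {..<p}"

definition sierpinski_adj :: "nat \<Rightarrow> (nat \<Rightarrow> nat) \<Rightarrow> (nat \<Rightarrow> nat) \<Rightarrow> bool" where
  "sierpinski_adj n s t \<longleftrightarrow>
     (\<exists>\<delta>\<in>{1..n}. (\<forall>d\<in>{\<delta><..n}. s d = t d) \<and> s \<delta> \<noteq> t \<delta> \<and>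
                 (\<forall>d\<in>{1..<\<delta>}. s d = t \<delta> \<and> t d = s \<delta>))"

definition sierpinski_graph :: "nat \<Rightarrow> nat \<Rightarrow> (nat \<Rightarrow> nat) pair_pre_digraph" where
  "sierpinski_graph p n =
     \<lparr> pverts = sierpinski_verts p n,
       parcs = {(s, t). s \<in> sierpinski_verts p n \<and> t \<in> sierpinski_verts p n \<and>
                        sierpinski_adj n s t} \<rparr>"

lemma sierpinski_adj_sym:
  assumes "sierpinski_adj n s t"
  shows "sierpinski_adj n t s"
proof -
  obtain \<delta> where "\<delta> \<in> {1..n}" "\<forall>d\<in>{\<delta><..n}. s d = t d" "s \<delta> \<noteq> t \<delta>"
    "\<forall>d\<in>{1..<\<delta>}. s d = t \<delta> \<and> t d = s \<delta>"
    using assms unfolding sierpinski_adj_def by blast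
  then show ?thesis
    unfolding sierpinski_adj_def by (intro bexI[of _ \<delta>]) auto
qed

lemma sierpinski_adj_irrefl: "\<not> sierpinski_adj n s s"
  by (simp add: sierpinski_adj_def)

lemma pair_graph_sierpinski: "pair_graph (sierpinski_graph p n)"
proof -
  have fin: "finite (sierpinski_verts p n)"
    unfolding sierpinski_verts_def by (rule finite_PiE) simp_all
  have sub: "parcs (sierpinski_graph p n) \<subseteq> sierpinski_verts p n \<times> sierpinski_verts p n"
    by (auto simp: sierpinski_graph_def)
  show ?thesis
  proof unfold_locales
    show "finite (pverts (sierpinski_graph p n))"
      using fin by (simp add: sierpinski_graph_def)
    show "finite (parcs (sierpinski_graph p n))"
      using finite_subset[OF sub] fin by simp
    show "symmetric (with_proj (sierpinski_graph p n))"
      by (auto simp: symmetric_def sym_def sierpinski_graph_def sierpinski_adj_sym)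
  next
    fix e assume e: "e \<in> parcs (sierpinski_graph p n)"
    show "fst e \<in> pverts (sierpinski_graph p n)" "snd e \<in> pverts (sierpinski_graph p n)"
      using e by (auto simp: sierpinski_graph_def)
    show "fst e \<noteq> snd e"
      using e by (auto simp: sierpinski_graph_def sierpinski_adj_irrefl)
  qed
qed

end

theory Submission
  imports Defs
begin

text \<open>
  Fixing all letters but the last one splits \<open>S\<^sub>p\<^sup>n\<close> into cliques of order \<open>p\<close>; a vertex has at
  most one neighbor outside its clique, and none if it is extreme (constant).
  If \<open>p \<ge> 3\<close>, an EOD set meets every clique in exactly one vertex, so it has \<open>p\<^sup>n\<^sup>-\<^sup>1\<close> elements;
  mapping a member to its unique neighbor in the set is a fixed-point free involution, so this
  number is even.
  Conversely, for even \<open>p\<close> pair each letter \<open>i\<close> with \<open>\<sigma> i\<close>; the words with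
  \<open>s\<^sub>1 = \<sigma> s\<^sub>2\<close> form an EOD set.
  An ECD set is a regular language: an automaton whose state is empty or one remembered letter
  stores the letter read if empty, forgets the remembered letter when reading it again, and
  ignores all other letters; the ECD set consists of the words that leave it empty, where the
  initial state is empty if \<open>n\<close> is even and \<open>0\<close> if \<open>n\<close> is odd.
  A clique whose common prefix leaves a letter remembered contains exactly one member, which
  dominates it, and no outer neighbor of its vertices is a member; if the prefix leaves the state
  empty, the clique has no member, every vertex has an outer neighbor (extreme cliques are excluded
  by the choice of the initial state), and all these outer neighbors are members.
\<close>

section \<open>Neighborhoods\<close>

text \<open>Covering becomes existence and disjointness becomes uniqueness; a candidate set can then
  be checked one vertex at a time.\<close>

lemma disjoint_cover_iff_ex1:
  assumes "\<And>v. v \<in> P \<Longrightarrow> N v \<subseteq> V"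
  shows "disjoint_family_on N P \<and> (\<Union>v\<in>P. N v) = V \<longleftrightarrow> (\<forall>u\<in>V. \<exists>!v. v \<in> P \<and> u \<in> N v)"
    (is "?L \<longleftrightarrow> ?R")
proof
  assume L: ?L
  show ?R
  proof
    fix u assume "u \<in> V"
    with L obtain v where v: "v \<in> P" "u \<in> N v" by blast
    moreover have "w = v" if "w \<in> P" "u \<in> N w" for w
      using L v that by (auto simp: disjoint_family_on_def)
    ultimately show "\<exists>!v. v \<in> P \<and> u \<in> N v" by blast
  qed
next
  assume ?R
  then show ?L
    using assms by (simp add: disjoint_family_on_def set_eq_iff subset_iff) metis
qed

lemma pverts_sierpinski [simp]: "pverts (sierpinski_graph p n) = sierpinski_verts p n"
  by (simp add: sierpinski_graph_def)

lemma open_nbhd_sierpinski: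
  "open_nbhd (sierpinski_graph p n) v =
     (if v \<in> sierpinski_verts p n then {u \<in> sierpinski_verts p n. sierpinski_adj n u v} else {})"
  by (auto simp: open_nbhd_def sierpinski_graph_def sierpinski_adj_sym)

lemma is_ECD_set_sierpinski_iff:
  "is_ECD_set (sierpinski_graph p n) P \<longleftrightarrow> P \<subseteq> sierpinski_verts p n \<and>
     (\<forall>u\<in>sierpinski_verts p n. \<exists>!v. v \<in> P \<and> (u = v \<or> sierpinski_adj n u v))"
proof (cases "P \<subseteq> sierpinski_verts p n")
  case True
  have "is_ECD_set (sierpinski_graph p n) P \<longleftrightarrow>
    (\<forall>u\<in>sierpinski_verts p n. \<exists>!v. v \<in> P \<and> u \<in> closed_nbhd (sierpinski_graph p n) v)"
    unfolding is_ECD_set_def using True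
    by (subst disjoint_cover_iff_ex1[symmetric])
      (auto simp: closed_nbhd_def open_nbhd_sierpinski split: if_splits)
  also have "\<dots> \<longleftrightarrow> (\<forall>u\<in>sierpinski_verts p n. \<exists>!v. v \<in> P \<and> (u = v \<or> sierpinski_adj n u v))"
    using True by (intro ball_cong refl arg_cong[where f = Ex1] ext)
      (auto simp: closed_nbhd_def open_nbhd_sierpinski)
  finally show ?thesis using True by simp
qed (simp add: is_ECD_set_def)

lemma is_EOD_set_sierpinski_iff:
  "is_EOD_set (sierpinski_graph p n) D \<longleftrightarrow> D \<subseteq> sierpinski_verts p n \<and>
     (\<forall>u\<in>sierpinski_verts p n. \<exists>!v. v \<in> D \<and> sierpinski_adj n u v)"
proof (cases "D \<subseteq> sierpinski_verts p n")
  case True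
  have "is_EOD_set (sierpinski_graph p n) D \<longleftrightarrow>
    (\<forall>u\<in>sierpinski_verts p n. \<exists>!v. v \<in> D \<and> u \<in> open_nbhd (sierpinski_graph p n) v)"
    unfolding is_EOD_set_def using True
    by (subst disjoint_cover_iff_ex1[symmetric])
      (auto simp: open_nbhd_sierpinski split: if_splits)
  also have "\<dots> \<longleftrightarrow> (\<forall>u\<in>sierpinski_verts p n. \<exists>!v. v \<in> D \<and> sierpinski_adj n u v)"
    using True by (intro ball_cong refl arg_cong[where f = Ex1] ext)
      (auto simp: open_nbhd_sierpinski)
  finally show ?thesis using True by simp
qed (simp add: is_EOD_set_def)

text \<open>
  If \<open>k\<close> is the first position with a letter other than \<open>s\<^sub>1\<close>, then
  \<open>cross k s\<close> is the only neighbor of \<open>s\<close> outside its clique.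
\<close>

definition cross :: "nat \<Rightarrow> (nat \<Rightarrow> nat) \<Rightarrow> nat \<Rightarrow> nat" where
  "cross k s = (\<lambda>d. if d \<in> {1..<k} then s k else if d = k then s 1 else s d)"

definition runs_to :: "nat \<Rightarrow> (nat \<Rightarrow> nat) \<Rightarrow> nat \<Rightarrow> bool" where
  "runs_to n s k \<longleftrightarrow> k \<in> {2..n} \<and> (\<exists>a. (\<forall>d\<in>{1..<k}. s d = a) \<and> s k \<noteq> a)"

lemma runs_toD: "runs_to n s k \<Longrightarrow> 1 \<le> d \<Longrightarrow> d < k \<Longrightarrow> s d = s 1"
  by (auto simp: runs_to_def)

lemma runs_to_neq: "runs_to n s k \<Longrightarrow> s k \<noteq> s 1"
  by (auto simp: runs_to_def)

lemma runs_to_bounds: "runs_to n s k \<Longrightarrow> 2 \<le> k \<and> k \<le> n"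
  by (simp add: runs_to_def)

text \<open>Were \<open>k < l\<close>, position \<open>k\<close> would lie inside the run of letters
  \<open>s 1\<close> that ends before \<open>l\<close>, against
  \<open>s k \<noteq> s 1\<close>.\<close>

lemma runs_to_unique:
  assumes "runs_to n s k" "runs_to n s l"
  shows "k = l"
  using assms[THEN runs_to_neq] assms[THEN runs_to_bounds]
    runs_toD[OF assms(1), of l] runs_toD[OF assms(2), of k]
  by (cases k l rule: linorder_cases) auto

lemma runs_to_cross: "runs_to n s k \<Longrightarrow> runs_to n (cross k s) k"
  by (auto simp: runs_to_def cross_def)

lemma cross_cross: "runs_to n s k \<Longrightarrow> cross k (cross k s) = s"
  by (auto simp: runs_to_def cross_def fun_eq_iff)

lemma runs_to_exists:
  assumes "\<exists>d\<in>{1..n}. s d \<noteq> s 1"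
  shows "\<exists>k. runs_to n s k"
proof -
  obtain k where "k \<in> {1..n} \<and> s k \<noteq> s 1"
    and least: "\<forall>d<k. \<not> (d \<in> {1..n} \<and> s d \<noteq> s 1)"
    using assms unfolding Bex_def exists_least_iff[of "\<lambda>d. d \<in> {1..n} \<and> s d \<noteq> s 1"] by blast
  then have k: "k \<in> {1..n}" "s k \<noteq> s 1" by blast+
  have "\<forall>d\<in>{1..<k}. s d = s 1"
  proof
    fix d assume d: "d \<in> {1..<k}"
    then have "d \<in> {1..n}" "d < k" using k(1) by auto
    then show "s d = s 1" using least by blast
  qed
  moreover have "k \<noteq> 1" using k(2) by metis
  then have "k \<in> {2..n}" using k(1) by simp
  ultimately have "runs_to n s k"
    using k(2) unfolding runs_to_def by (intro conjI exI[of _ "s 1"])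
  then show ?thesis ..
qed

lemma sierpinski_verts_upd [unfolded One_nat_def, simp]:
  "s \<in> sierpinski_verts p n \<Longrightarrow> 1 \<le> n \<Longrightarrow> j < p \<Longrightarrow> s(1 := j) \<in> sierpinski_verts p n"
  unfolding sierpinski_verts_def by (auto simp: PiE_iff extensional_def)

lemma sierpinski_verts_less: "s \<in> sierpinski_verts p n \<Longrightarrow> d \<in> {1..n} \<Longrightarrow> s d < p"
  unfolding sierpinski_verts_def by (auto simp: PiE_iff)

lemma sierpinski_verts_outside:
  "s \<in> sierpinski_verts p n \<Longrightarrow> d \<notin> {1..n} \<Longrightarrow> s d = undefined"
  unfolding sierpinski_verts_def by (rule PiE_arb)

lemma sierpinski_verts_cross:
  "s \<in> sierpinski_verts p n \<Longrightarrow> runs_to n s k \<Longrightarrow> cross k s \<in> sierpinski_verts p n"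
  unfolding sierpinski_verts_def runs_to_def cross_def
  by (auto simp: PiE_iff extensional_def)

text \<open>The case \<delta> = 1 changes only the last letter and stays in the clique. For \<delta>
  \<ge> 2 the letters of \<open>s\<close> below \<delta> all equal \<open>t \<delta>\<close>, hence
  \<open>s 1\<close>, so the run ends at \<delta> and \<open>t\<close> is determined.\<close>

lemma sierpinski_adj_iff:
  assumes s: "s \<in> sierpinski_verts p n" and t: "t \<in> sierpinski_verts p n" and n: "1 \<le> n"
  shows "sierpinski_adj n s t \<longleftrightarrow>
    (\<exists>j. j \<noteq> s 1 \<and> t = s(1 := j)) \<or> (\<exists>k. runs_to n s k \<and> t = cross k s)"
    (is "_ \<longleftrightarrow> ?R")
proof
  assume "sierpinski_adj n s t"
  then obtain k where k: "k \<in> {1..n}" "\<forall>d\<in>{k<..n}. s d = t d" "s k \<noteq> t k"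
    "\<forall>d\<in>{1..<k}. s d = t k \<and> t d = s k"
    unfolding sierpinski_adj_def by blast
  have out: "s d = t d" if "d \<notin> {1..n}" for d
    using sierpinski_verts_outside[OF s that] sierpinski_verts_outside[OF t that] by simp
  show ?R
  proof (cases "k = 1")
    case True
    have "t d = (s(1 := t 1)) d" for d
      using k out[of d] True by (cases "d \<in> {1..n}") auto
    then have "t = s(1 := t 1)" by blast
    then show ?thesis using k True by metis
  next
    case False
    then have k2: "1 \<in> {1..<k}" using k(1) by auto
    then have s1: "s 1 = t k" using k(4) by blast
    have "t d = cross k s d" for d
    proof -
      consider "d \<notin> {1..n}" | "d \<in> {k<..n}" | "d = k" | "d \<in> {1..<k}" by fastforce
      then show ?thesis
      proof cases
        case 1
        then show ?thesis using out[of d] k(1) by (auto simp: cross_def)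
      qed (use k s1 in \<open>auto simp: cross_def\<close>)
    qed
    then have "t = cross k s" by blast
    moreover have "runs_to n s k"
      unfolding runs_to_def using k False by (intro conjI exI[of _ "t k"]) auto
    ultimately show ?thesis by blast
  qed
next
  assume ?R
  then show "sierpinski_adj n s t"
  proof
    assume "\<exists>j. j \<noteq> s 1 \<and> t = s(1 := j)"
    then show ?thesis
      using n unfolding sierpinski_adj_def by (intro bexI[of _ 1]) auto
  next
    assume "\<exists>k. runs_to n s k \<and> t = cross k s"
    then obtain k where "runs_to n s k" "t = cross k s" by blast
    then show ?thesis
      unfolding sierpinski_adj_def by (intro bexI[of _ k]) (auto simp: runs_to_def cross_def)
  qed
qed

section \<open>The ECD set\<close>

fun step :: "nat option \<Rightarrow> nat \<Rightarrow> nat option" where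
  "step None i = Some i"
| "step (Some j) i = (if i = j then None else Some j)"

text \<open>The state after reading \<open>s\<^sub>n \<dots> s\<^sub>m\<close>, most significant letter first.\<close>

definition state :: "nat \<Rightarrow> (nat \<Rightarrow> nat) \<Rightarrow> nat \<Rightarrow> nat option" where
  "state n s m = foldr (\<lambda>d q. step q (s d)) [m..<Suc n] (if even n then None else Some 0)"

definition ecd_set :: "nat \<Rightarrow> nat \<Rightarrow> (nat \<Rightarrow> nat) set" where
  "ecd_set p n = {s \<in> sierpinski_verts p n. state n s 1 = None}"

lemma state_rec: "m \<le> n \<Longrightarrow> state n s m = step (state n s (Suc m)) (s m)"
  by (simp add: state_def upt_conv_Cons del: upt_Suc)

lemma state_start: "state n s (Suc n) = (if even n then None else Some 0)"
  by (simp add: state_def)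

lemma state_cong:
  assumes "\<And>d. m \<le> d \<Longrightarrow> d \<le> n \<Longrightarrow> s d = t d"
  shows "state n s m = state n t m"
  unfolding state_def by (intro foldr_cong) (auto simp: assms)

lemma state_less:
  assumes "s \<in> sierpinski_verts p n" "0 < p" "1 \<le> m" "m \<le> Suc n" "state n s m = Some i"
  shows "i < p"
  using assms(4,3,5)
proof (induction m rule: inc_induct)
  case base
  then show ?case using assms(2) by (simp add: state_start split: if_splits)
next
  case (step m)
  then show ?case
    using sierpinski_verts_less[OF assms(1), of m]
    by (cases "state n s (Suc m)") (auto simp: state_rec split: if_splits)
qed

text \<open>Reading the same letter twice restores every state, so only the parity of the run length
  counts.\<close>

lemma state_run:
  assumes "m \<le> k" "k \<le> Suc n" "\<And>d. m \<le> d \<Longrightarrow> d < k \<Longrightarrow> s d = c"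
  shows "state n s m =
    (if even (k - m) then state n s k else step (state n s k) c)"
  using assms(1,3)
proof (induction m rule: inc_induct)
  case (step m)
  have st: "state n s m = step (state n s (Suc m)) c"
    using step.hyps step.prems assms(2) by (simp add: state_rec)
  have ev: "even (k - m) \<longleftrightarrow> odd (k - Suc m)"
    using step.hyps by (simp add: Suc_diff_Suc[symmetric])
  show ?case
    using step.IH step.prems st ev by (cases "state n s k") auto
qed simp

text \<open>Let q be the state before position \<open>k\<close> is read. One word continues with
  \<open>s k\<close> and then \<open>k - 2\<close> letters \<open>s 1\<close>, the other with
  \<open>s 1\<close> and then \<open>k - 1\<close> letters \<open>s k\<close>. Both conditions say q
  = \<open>Some (s k)\<close> for even \<open>k\<close> and q = \<open>Some (s 1)\<close> for odd
  \<open>k\<close>.\<close>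

lemma cross_in_ecd_set_iff:
  assumes s: "s \<in> sierpinski_verts p n" and k: "runs_to n s k"
  shows "cross k s \<in> ecd_set p n \<longleftrightarrow> state n s 2 = None"
proof -
  have k2: "2 \<le> k" "k \<le> n" and ne: "s k \<noteq> s 1"
    using runs_to_bounds[OF k] runs_to_neq[OF k] by blast+
  have "state n s 2 = (if even (k - 2) then state n s k else step (state n s k) (s 1))"
    using k2 by (intro state_run runs_toD[OF k]) simp_all
  moreover have "state n (cross k s) 1 =
    (if even (k - 1) then state n (cross k s) k else step (state n (cross k s) k) (s k))"
    using k2 by (intro state_run) (simp_all add: cross_def)
  moreover have "state n s k = step (state n s (Suc k)) (s k)"
    using k2 by (simp add: state_rec)
  moreover have "state n (cross k s) k = step (state n s (Suc k)) (s 1)"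
    using k2 state_cong[of "Suc k" n "cross k s" s] by (simp add: state_rec cross_def)
  moreover have "even (k - 2) \<longleftrightarrow> odd (k - 1)" using k2 by auto
  ultimately show ?thesis
    using ne sierpinski_verts_cross[OF s k]
    by (cases "state n s (Suc k)") (auto simp: ecd_set_def)
qed

text \<open>Only reading the remembered letter empties the state, so a clique has at most one
  member.\<close>

lemma upd_in_ecd_set_iff:
  assumes "s \<in> sierpinski_verts p n" "1 \<le> n" "j < p"
  shows "s(1 := j) \<in> ecd_set p n \<longleftrightarrow> state n s 2 = Some j"
proof -
  have "state n (s(1 := j)) 1 = step (state n s 2) j"
    using state_cong[of 2 n "s(1 := j)" s] assms(2) by (simp add: state_rec numeral_2_eq_2)
  then show ?thesis
    using assms by (cases "state n s 2") (auto simp: ecd_set_def)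
qed

lemma is_ECD_set_ecd_set:
  assumes p: "0 < p" and n: "1 \<le> n"
  shows "is_ECD_set (sierpinski_graph p n) (ecd_set p n)"
  unfolding is_ECD_set_sierpinski_iff
proof (intro conjI ballI)
  show sub: "ecd_set p n \<subseteq> sierpinski_verts p n" by (auto simp: ecd_set_def)
  fix s assume s: "s \<in> sierpinski_verts p n"
  \<comment> \<open>Allowing \<open>j = s 1\<close> absorbs the case \<open>s = t\<close>: the
    closed neighborhood is the whole clique plus the outer neighbor, if there is one.\<close>
  have nbr: "t \<in> ecd_set p n \<and> (s = t \<or> sierpinski_adj n s t) \<longleftrightarrow> t \<in> ecd_set p n \<and>
    ((\<exists>j<p. t = s(1 := j)) \<or> (\<exists>k. runs_to n s k \<and> t = cross k s))" for t
  proof (cases "t \<in> ecd_set p n")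
    case True
    then have t: "t \<in> sierpinski_verts p n" using sub by auto
    have "s 1 < p" "t 1 < p"
      using sierpinski_verts_less[OF t, of 1] sierpinski_verts_less[OF s, of 1] n by simp_all
    then have "(s = t \<or> (\<exists>j. j \<noteq> s 1 \<and> t = s(1 := j))) \<longleftrightarrow> (\<exists>j<p. t = s(1 := j))"
      by (metis fun_upd_same fun_upd_triv)
    then show ?thesis using sierpinski_adj_iff[OF s t n] by blast
  qed simp
  show "\<exists>!t. t \<in> ecd_set p n \<and> (s = t \<or> sierpinski_adj n s t)"
    unfolding nbr
  proof (cases "state n s 2")
    case None
    \<comment> \<open>For constant \<open>s\<close> the \<open>n - 1\<close> equal letters read so
      far are odd in number starting from \<open>None\<close>, or even in number starting from
      \<open>Some 0\<close>; neither ends in \<open>None\<close>.\<close>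
    have "\<exists>d\<in>{1..n}. s d \<noteq> s 1"
    proof (rule ccontr)
      assume "\<not> ?thesis"
      then have const: "s d = s 1" if "1 \<le> d" "d \<le> n" for d
        using that by (meson atLeastAtMost_iff)
      have "state n s 2 = (if even (Suc n - 2) then state n s (Suc n)
          else step (state n s (Suc n)) (s 1))"
        using n by (intro state_run const) simp_all
      with None n show False
        by (cases "even n") (auto simp: state_start split: if_splits)
    qed
    then obtain k where k: "runs_to n s k" using runs_to_exists by blast
    show "\<exists>!t. t \<in> ecd_set p n \<and>
      ((\<exists>j<p. t = s(1 := j)) \<or> (\<exists>k. runs_to n s k \<and> t = cross k s))"
    proof (rule ex1I[of _ "cross k s"])
      show "cross k s \<in> ecd_set p n \<and> ((\<exists>j<p. cross k s = s(1 := j)) \<or>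
        (\<exists>k'. runs_to n s k' \<and> cross k s = cross k' s))"
        using k None cross_in_ecd_set_iff[OF s k] by blast
    next
      fix t assume "t \<in> ecd_set p n \<and>
        ((\<exists>j<p. t = s(1 := j)) \<or> (\<exists>k. runs_to n s k \<and> t = cross k s))"
      then show "t = cross k s"
        using upd_in_ecd_set_iff[OF s n] None runs_to_unique[OF k] by auto
    qed
  next
    case (Some i)
    have "i < p" using state_less[OF s p _ _ Some] n by simp
    show "\<exists>!t. t \<in> ecd_set p n \<and>
      ((\<exists>j<p. t = s(1 := j)) \<or> (\<exists>k. runs_to n s k \<and> t = cross k s))"
    proof (rule ex1I[of _ "s(1 := i)"])
      show "s(1 := i) \<in> ecd_set p n \<and> ((\<exists>j<p. s(1 := i) = s(1 := j)) \<or>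
        (\<exists>k. runs_to n s k \<and> s(1 := i) = cross k s))"
        using \<open>i < p\<close> Some upd_in_ecd_set_iff[OF s n] by blast
    next
      fix t assume "t \<in> ecd_set p n \<and>
        ((\<exists>j<p. t = s(1 := j)) \<or> (\<exists>k. runs_to n s k \<and> t = cross k s))"
      then show "t = s(1 := i)"
        using upd_in_ecd_set_iff[OF s n] Some cross_in_ecd_set_iff[OF s] by auto
    qed
  qed
qed

section \<open>The EOD set for even \<open>p\<close>\<close>

text \<open>One choice of the pairing \<sigma>: the pairs are \<open>{2i, 2i + 1}\<close>.\<close>

definition mate :: "nat \<Rightarrow> nat" where
  "mate i = (if even i then Suc i else i - 1)"

lemma mate_mate [simp]: "mate (mate i) = i"
  by (simp add: mate_def)

lemma mate_neq [simp]: "mate i \<noteq> i"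
  by (auto simp: mate_def elim: oddE)

lemma mate_less: "even p \<Longrightarrow> i < p \<Longrightarrow> mate i < p"
  by (auto simp: mate_def elim!: evenE)

lemma is_EOD_set_mate:
  assumes p: "even p" and n: "2 \<le> n"
  shows "is_EOD_set (sierpinski_graph p n) {s \<in> sierpinski_verts p n. s 1 = mate (s 2)}"
    (is "is_EOD_set _ ?D")
  unfolding is_EOD_set_sierpinski_iff
proof (intro conjI ballI)
  show "?D \<subseteq> sierpinski_verts p n" by auto
  fix s assume s: "s \<in> sierpinski_verts p n"
  have n1: "1 \<le> n" using n by simp
  have nbr: "t \<in> ?D \<and> sierpinski_adj n s t \<longleftrightarrow> t \<in> ?D \<and>
    ((\<exists>j. j \<noteq> s 1 \<and> t = s(1 := j)) \<or> (\<exists>k. runs_to n s k \<and> t = cross k s))" for t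
    using sierpinski_adj_iff[OF s _ n1, of t] by blast
  \<comment> \<open>For \<open>k = 2\<close> the outer neighbor swaps the last two letters, and
    \<open>mate\<close> is an involution. For \<open>k > 2\<close> its last two letters are both
    \<open>s k\<close>, but \<open>mate\<close> has no fixed point.\<close>
  have cross: "cross k s \<in> ?D \<longleftrightarrow> k = 2 \<and> s 1 = mate (s 2)" if "runs_to n s k" for k
  proof (cases "k = 2")
    case True
    then show ?thesis
      using sierpinski_verts_cross[OF s that] by (auto simp: cross_def)
  next
    case False
    then have "2 < k" using that by (auto simp: runs_to_def)
    then show ?thesis by (auto simp: cross_def mate_neq[symmetric])
  qed
  \<comment> \<open>If \<open>s\<close> is a member, it is the only one in its clique and is not its
    own neighbor, so the outer neighbor must serve; otherwise the member in the clique does.\<close>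
  show "\<exists>!t. t \<in> ?D \<and> sierpinski_adj n s t"
  proof (cases "s 1 = mate (s 2)")
    case True
    then have "s 2 \<noteq> s 1" by (metis mate_neq)
    then have r: "runs_to n s 2"
      using n unfolding runs_to_def by (intro conjI exI[of _ "s 1"]) (auto simp: numeral_2_eq_2 le_less_Suc_eq)
    show ?thesis
      unfolding nbr
    proof (rule ex1I[of _ "cross 2 s"])
      show "cross 2 s \<in> ?D \<and>
        ((\<exists>j. j \<noteq> s 1 \<and> cross 2 s = s(1 := j)) \<or> (\<exists>k. runs_to n s k \<and> cross 2 s = cross k s))"
        using cross[OF r] True r by blast
    next
      fix t assume "t \<in> ?D \<and>
        ((\<exists>j. j \<noteq> s 1 \<and> t = s(1 := j)) \<or> (\<exists>k. runs_to n s k \<and> t = cross k s))"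
      then show "t = cross 2 s"
        using runs_to_unique[OF r] True by auto
    qed
  next
    case False
    have v: "s(1 := mate (s 2)) \<in> sierpinski_verts p n"
      using s n mate_less[OF p] sierpinski_verts_less[OF s, of 2] by simp
    show ?thesis
      unfolding nbr
    proof (rule ex1I[of _ "s(1 := mate (s 2))"])
      show "s(1 := mate (s 2)) \<in> ?D \<and> ((\<exists>j. j \<noteq> s 1 \<and> s(1 := mate (s 2)) = s(1 := j)) \<or>
        (\<exists>k. runs_to n s k \<and> s(1 := mate (s 2)) = cross k s))"
        using v False by (simp, metis)
    next
      fix t assume "t \<in> ?D \<and>
        ((\<exists>j. j \<noteq> s 1 \<and> t = s(1 := j)) \<or> (\<exists>k. runs_to n s k \<and> t = cross k s))"
      then show "t = s(1 := mate (s 2))"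
        using cross False by auto
    qed
  qed
qed

section \<open>No EOD set for odd \<open>p\<close>\<close>

text \<open>Removing an orbit \<open>{x, f x}\<close>, which has two elements, leaves a smaller set
  still closed under \<open>f\<close>.\<close>

lemma even_card_involution:
  assumes "finite A" "\<And>x. x \<in> A \<Longrightarrow> f x \<in> A" "\<And>x. x \<in> A \<Longrightarrow> f (f x) = x"
    "\<And>x. x \<in> A \<Longrightarrow> f x \<noteq> x"
  shows "even (card A)"
  using assms
proof (induction A rule: finite_psubset_induct)
  case (psubset A)
  show ?case
  proof (cases "A = {}")
    case False
    then obtain x where x: "x \<in> A" by blast
    let ?B = "A - {x, f x}"
    have "even (card ?B)"
    proof (rule psubset.IH)
      show "?B \<subset> A" using x by blast
      fix y assume y: "y \<in> ?B"
      then show "f y \<in> ?B" "f (f y) = y" "f y \<noteq> y"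
        using psubset.prems x by (auto, metis+)
    qed
    moreover have "card A = card ?B + card {x, f x}"
      using psubset.hyps psubset.prems(1) x
      by (metis add.commute card_Diff_subset card_mono empty_subsetI finite.emptyI
          finite.insertI insert_subset le_add_diff_inverse)
    moreover have "card {x, f x} = 2" using psubset.prems(3)[OF x] by simp
    ultimately show ?thesis by simp
  qed simp
qed

lemma even_card_EOD_set:
  assumes "is_EOD_set (sierpinski_graph p n) D"
  shows "even (card D)"
proof -
  have D: "D \<subseteq> sierpinski_verts p n"
    and ex1: "\<And>s. s \<in> sierpinski_verts p n \<Longrightarrow> \<exists>!t. t \<in> D \<and> sierpinski_adj n s t"
    using assms by (auto simp: is_EOD_set_sierpinski_iff)
  define f where "f s = (THE t. t \<in> D \<and> sierpinski_adj n s t)" for s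
  have f: "f s \<in> D" "sierpinski_adj n s (f s)" if "s \<in> D" for s
    using theI'[OF ex1, of s] that D by (auto simp: f_def)
  have "f (f s) = s" if "s \<in> D" for s
    using f[OF that] f[OF f(1)[OF that]] ex1[of "f s"] that D sierpinski_adj_sym by blast
  moreover have "finite D"
    using D by (rule finite_subset) (simp add: sierpinski_verts_def finite_PiE)
  ultimately show ?thesis
    using f sierpinski_adj_irrefl by (intro even_card_involution[of D f]) metis+
qed

lemma card_EOD_set:
  assumes p: "3 \<le> p" and n: "1 \<le> n" and EOD: "is_EOD_set (sierpinski_graph p n) D"
  shows "card D = p ^ (n - 1)"
proof -
  have D: "D \<subseteq> sierpinski_verts p n"
    and ex1: "\<And>s. s \<in> sierpinski_verts p n \<Longrightarrow> \<exists>!t. t \<in> D \<and> sierpinski_adj n s t"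
    using EOD by (auto simp: is_EOD_set_sierpinski_iff)
  have adj_upd: "sierpinski_adj n s (s(1 := j))"
    if "s \<in> sierpinski_verts p n" "j < p" "j \<noteq> s 1" for s j
    using that n by (subst sierpinski_adj_iff) auto
  \<comment> \<open>Two members in one clique would both dominate a third vertex of it, which exists
    because \<open>p \<ge> 3\<close>.\<close>
  have once: "j = s 1" if s: "s \<in> D" and j: "s(1 := j) \<in> D" for s j
  proof (rule ccontr)
    assume ne: "j \<noteq> s 1"
    have sv: "s \<in> sierpinski_verts p n" using s D by blast
    have "j < p" using sierpinski_verts_less[of "s(1 := j)" p n 1] j D n by auto
    obtain i where i: "i < p" "i \<noteq> j" "i \<noteq> s 1"
    proof -
      have "\<not> {..<p} \<subseteq> {j, s 1}"
        using card_mono[of "{j, s 1}" "{..<p}"] p card_insert_le_m1[of 2 "{s 1}" j] by auto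
      then show ?thesis using that by auto
    qed
    let ?u = "s(1 := i)"
    have u: "?u \<in> sierpinski_verts p n" using sv n i by simp
    have "sierpinski_adj n ?u s"
      using adj_upd[OF u, of "s 1"] i sierpinski_verts_less[OF sv, of 1] n by simp
    moreover have "sierpinski_adj n ?u (s(1 := j))"
      using adj_upd[OF u, of j] i \<open>j < p\<close> by simp
    ultimately have "s = s(1 := j)" using ex1[OF u] s j by blast
    then show False using ne by (metis fun_upd_same)
  qed
  \<comment> \<open>If the clique of \<open>s\<close> missed \<open>D\<close>, the outer neighbor
    \<open>t\<close> of \<open>s\<close> would be a member. By \<open>once\<close> the member
    dominating \<open>t\<close> lies outside the clique of \<open>t\<close>, so it is
    \<open>s\<close> itself.\<close>
  have meets: "\<exists>j. s(1 := j) \<in> D" if s: "s \<in> sierpinski_verts p n" for s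
  proof (rule ccontr)
    assume no: "\<not> ?thesis"
    obtain t where t: "t \<in> D" "sierpinski_adj n s t" using ex1[OF s] by blast
    then have tv: "t \<in> sierpinski_verts p n" using D by blast
    obtain k where k: "runs_to n s k" "t = cross k s"
      using t(2) no t(1) unfolding sierpinski_adj_iff[OF s tv n] by blast
    obtain u where u: "u \<in> D" "sierpinski_adj n t u" using ex1[OF tv] by blast
    then have uv: "u \<in> sierpinski_verts p n" using D by blast
    obtain l where l: "runs_to n t l" "u = cross l t"
      using u t once unfolding sierpinski_adj_iff[OF tv uv n] by blast
    have "l = k" using l(1) runs_to_cross[OF k(1)] k(2) runs_to_unique by blast
    then have "u = s" using l k cross_cross by blast
    then show False using u(1) no by (metis fun_upd_triv)
  qed
  \<comment> \<open>Erasing the last letter names the clique: \<open>once\<close> gives injectivity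
    and \<open>meets\<close> surjectivity.\<close>
  have "bij_betw (\<lambda>s. restrict s {2..n}) D ({2..n} \<rightarrow>\<^sub>E {..<p})"
    unfolding bij_betw_def
  proof
    show "inj_on (\<lambda>s. restrict s {2..n}) D"
    proof (rule inj_onI)
      fix s t assume st: "s \<in> D" "t \<in> D" "restrict s {2..n} = restrict t {2..n}"
      have "(s(1 := t 1)) d = t d" for d
      proof -
        consider "d = 1" | "d \<in> {2..n}" | "d \<noteq> 1" "d \<notin> {1..n}" by fastforce
        then show ?thesis
        proof cases
          case 2
          then show ?thesis using fun_cong[OF st(3), of d] by auto
        next
          case 3
          then show ?thesis
            using sierpinski_verts_outside[OF subsetD[OF D st(1)], of d]
              sierpinski_verts_outside[OF subsetD[OF D st(2)], of d] by simp
        qed simp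
      qed
      then have "s(1 := t 1) = t" by blast
      moreover from this have "t 1 = s 1" using once[OF st(1), of "t 1"] st(2) by simp
      ultimately show "s = t" by (metis fun_upd_triv)
    qed
    show "(\<lambda>s. restrict s {2..n}) ` D = {2..n} \<rightarrow>\<^sub>E {..<p}"
    proof
      show "(\<lambda>s. restrict s {2..n}) ` D \<subseteq> {2..n} \<rightarrow>\<^sub>E {..<p}"
        using D sierpinski_verts_less by (fastforce simp: PiE_iff)
      show "{2..n} \<rightarrow>\<^sub>E {..<p} \<subseteq> (\<lambda>s. restrict s {2..n}) ` D"
      proof
        fix w assume w: "w \<in> {2..n} \<rightarrow>\<^sub>E {..<p}"
        \<comment> \<open>As \<open>w\<close> has no letter at position 1, the letter 0 is filled in
          to obtain some vertex of the clique that \<open>w\<close> names.\<close>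
        have "w(1 := 0) \<in> sierpinski_verts p n"
          using w p n by (auto simp: sierpinski_verts_def PiE_iff extensional_def)
        then obtain j where j: "w(1 := j) \<in> D" using meets by fastforce
        moreover have "restrict (w(1 := j)) {2..n} = w"
          using w by (auto simp: fun_eq_iff PiE_iff extensional_def)
        ultimately show "w \<in> (\<lambda>s. restrict s {2..n}) ` D" by (metis image_eqI)
      qed
    qed
  qed
  then have "card D = card ({2..n} \<rightarrow>\<^sub>E {..<p})" by (rule bij_betw_same_card)
  also have "\<dots> = p ^ (n - 1)" by (simp add: card_PiE)
  finally show ?thesis .
qed

theorem theorem5p1:
  fixes p n :: nat
  assumes "p \<ge> 3" and "n \<ge> 2"
  shows "is_EOCD_graph (sierpinski_graph p n) \<longleftrightarrow> even p"
proof
  assume "is_EOCD_graph (sierpinski_graph p n)"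
  then obtain D where "is_EOD_set (sierpinski_graph p n) D"
    by (auto simp: is_EOCD_graph_def)
  then have "even (p ^ (n - 1))"
    using even_card_EOD_set card_EOD_set[of p n D] assms by fastforce
  then show "even p" by simp
next
  assume "even p"
  then show "is_EOCD_graph (sierpinski_graph p n)"
    unfolding is_EOCD_graph_def
    using is_ECD_set_ecd_set[of p n] is_EOD_set_mate[of p n] assms by auto
qed

end
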